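(* Let $d \geq 2$ and let $\mu$ be a Borel probability measure on $\mathbb{T}^d$. If the trace inequality holds for $\mu$, then $\mu$ is upper $(d-2)$-regular, and hence the Hausdorff dimension of the support of $\mu$ is $\geq d-2$.
   Context: $\mathbb{T}^d=\mathbb{R}^d/\mathbb{Z}^d$ with Lebesgue measure $dx$. $\sqrt{\mathbb{N}}=\{\sqrt n : n\in\mathbb{N}\}$. For $\lambda\in\sqrt{\mathbb{N}}$, $\mathcal{S}^{d-1}_\lambda=\{k\in\mathbb{Z}^d : |k|=\lambda\}$ and $E_\lambda=\{\sum_{k\in\mathcal{S}^{d-1}_\lambda} \widehat{u}_k e^{2\pi i k\cdot x} : \widehat{u}_k\in\mathbb{C}\}$ (the Laplace eigenspace with eigenvalue $-4\pi^2\lambda^2$). The trace inequality holds for $\mu$ if there is a finite constant $\mathfrak{C}$ such that $\int_{\mathbb{T}^d}|u|^2\,d\mu\le \mathfrak{C}\int_{\mathbb{T}^d}|u|^2\,dx$ for all $u\in\bigcup_{\lambda\in\sqrt{\mathbb{N}}}E_\lambda$. A Borel measure $\mu$ on $\mathbb{T}^d$ is upper $\alpha$-regular if there is a finite constant $C$ such that $\mu(B_r(x_0))\le C r^\alpha$ for all $x_0\in\mathbb{T}^d$ and all $r\in(0,1)$, where $B_r(x_0)$ is the geodesic ball centered at $x_0$ with radius $r$. *)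

theory Defs
  imports "HOL-Probability.Probability"
begin

section \<open>The flat torus\<close>

definition int_vec :: "int ^ 'n \<Rightarrow> real ^ 'n" where
  "int_vec k = (\<chi> i. real_of_int (k $ i))"

lemma int_vec_simps [simp]:
  "int_vec 0 = 0" "int_vec (- k) = - int_vec k"
  "int_vec (k + l) = int_vec k + int_vec l" "int_vec (k - l) = int_vec k - int_vec l"
  "int_vec k $ i = real_of_int (k $ i)"
  by (simp_all add: int_vec_def vec_eq_iff)

lemma int_vec_eq_iff [simp]: "int_vec k = int_vec l \<longleftrightarrow> k = l"
  by (simp add: vec_eq_iff)

lemma norm_int_vec_less_1:
  fixes k :: "int ^ 'n::finite"
  assumes "norm (int_vec k) < 1"
  shows "k = 0"
proof -
  have "\<bar>real_of_int (k $ i)\<bar> < 1" for i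
    using component_le_norm_cart[of "int_vec k" i] assms by simp
  then have "k $ i = 0" for i
    by (metis of_int_abs of_int_less_1_iff zabs_less_one_iff)
  then show ?thesis by (simp add: vec_eq_iff)
qed

definition lattice_rel :: "real ^ 'n \<Rightarrow> real ^ 'n \<Rightarrow> bool" where
  "lattice_rel x y \<longleftrightarrow> (\<exists>k. x - y = int_vec k)"

quotient_type 'n torus = "real ^ 'n::finite" / lattice_rel
  morphisms rep_torus to_torus
proof (rule equivpI)
  show "reflp (lattice_rel :: real ^ 'n \<Rightarrow> _)"
    by (auto simp: reflp_def lattice_rel_def intro: exI[of _ 0])
  show "symp (lattice_rel :: real ^ 'n \<Rightarrow> _)"
    unfolding symp_def lattice_rel_def by (metis int_vec_simps(2) minus_diff_eq)
  show "transp (lattice_rel :: real ^ 'n \<Rightarrow> _)"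
    unfolding transp_def lattice_rel_def
  proof clarify
    fix x y z :: "real ^ 'n" and k l assume "x - y = int_vec k" "y - z = int_vec l"
    then have "x - z = int_vec (k + l)" by (metis add_diff_eq diff_add_cancel int_vec_simps(3))
    then show "\<exists>k. x - z = int_vec k" ..
  qed
qed

lemma to_torus_eq_iff: "to_torus x = to_torus y \<longleftrightarrow> (\<exists>k. x - y = int_vec k)"
  by (simp add: torus.abs_eq_iff lattice_rel_def)

lemma to_torus_surj: "\<exists>a. to_torus a = x"
  by (metis Quotient3_abs_rep Quotient3_torus)

text \<open>
  The geodesics of the flat torus are the images of straight lines in \<open>\<real>\<^sup>d\<close>, so the geodesic
  distance is the infimum of the lengths of segments joining a lift of \<open>x\<close> to a lift of \<open>y\<close>.
  Consequently \<open>ball x r\<close> is the geodesic ball, and \<open>borel\<close> is the Borel sigma-algebra of the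
  quotient topology (lemma \<open>open_torus_iff\<close>).
\<close>

instantiation torus :: (finite) metric_space
begin

definition dist_torus :: "'a torus \<Rightarrow> 'a torus \<Rightarrow> real" where
  "dist_torus x y = setdist (to_torus -` {x}) (to_torus -` {y})"

definition uniformity_torus :: "('a torus \<times> 'a torus) filter" where
  "uniformity_torus = (INF e\<in>{0 <..}. principal {(x, y). dist x y < e})"

definition open_torus :: "'a torus set \<Rightarrow> bool" where
  "open_torus U \<longleftrightarrow> (\<forall>x\<in>U. eventually (\<lambda>(x', y). x' = x \<longrightarrow> y \<in> U) uniformity)"

lemma dist_torus_lessE:
  fixes a :: "real ^ 'a" and y :: "'a torus"
  assumes "dist (to_torus a) y < e"
  obtains b where "to_torus b = y" "dist a b < e"
proof -
  have ne: "to_torus -` {z} \<noteq> {}" for z :: "'a torus"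
    using to_torus_surj[of z] by auto
  obtain a' b' where *: "to_torus a' = to_torus a" "to_torus b' = y" "dist a' b' < e"
    using setdist_ltE[OF assms[unfolded dist_torus_def] ne ne] by auto
  then obtain k where k: "a' - a = int_vec k" by (auto simp: to_torus_eq_iff)
  show ?thesis
  proof
    have "b' - int_vec k - b' = int_vec (- k)" by simp
    then show "to_torus (b' - int_vec k) = y"
      using *(2) to_torus_eq_iff by metis
    have "a - (b' - int_vec k) = a' - b'" unfolding k[symmetric] by (simp add: algebra_simps)
    then show "dist a (b' - int_vec k) < e" using *(3) by (simp only: dist_norm)
  qed
qed

lemma dist_to_torus_le: "dist (to_torus a) (to_torus b) \<le> dist a b"
  unfolding dist_torus_def by (rule setdist_le_dist) auto

instance
proof
  fix x y z :: "'a torus"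
  have sym: "dist u v = dist v u" for u v :: "'a torus"
    by (simp add: dist_torus_def setdist_sym)
  show "dist x y = 0 \<longleftrightarrow> x = y"
  proof
    assume 0: "dist x y = 0"
    obtain a where a: "to_torus a = x" using to_torus_surj by blast
    have ex: "\<exists>b. to_torus b = y \<and> dist a b < e" if "e > 0" for e
      using dist_torus_lessE[of a y e] 0 a that by auto
    obtain b where b: "to_torus b = y" "dist a b < 1/2" using ex[of "1/2"] by auto
    have "dist a b \<le> e" if e: "e > 0" for e
    proof -
      obtain b' where b': "to_torus b' = y" "dist a b' < min e (1/2)"
        using ex[of "min e (1/2)"] e by auto
      obtain k where k: "b' - b = int_vec k" using b b' to_torus_eq_iff by metis
      have "norm (int_vec k) < 1"
        unfolding k[symmetric] using dist_triangle_less_add[of b' a "1/2" b "1/2"] b b'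
        by (simp add: dist_norm norm_minus_commute)
      then have "b' = b" using norm_int_vec_less_1[of k] k by simp
      then show ?thesis using b' by simp
    qed
    then have "dist a b \<le> 0" using field_le_epsilon[of "dist a b" 0] by simp
    then show "x = y" using a b by simp
  next
    assume "x = y"
    then show "dist x y = 0" by (simp add: dist_torus_def setdist_refl)
  qed
  show "dist x y \<le> dist x z + dist y z"
  proof (rule field_le_epsilon)
    fix e :: real assume e: "e > 0"
    obtain a where a: "to_torus a = x" using to_torus_surj by blast
    obtain c where c: "to_torus c = z" "dist a c < dist x z + e/2"
      using dist_torus_lessE[of a z "dist x z + e/2"] a e by auto
    obtain b where b: "to_torus b = y" "dist c b < dist z y + e/2"
      using dist_torus_lessE[of c y "dist z y + e/2"] c e by auto
    have "dist x y \<le> dist a b" using dist_to_torus_le[of a b] a b by simp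
    also have "\<dots> \<le> dist a c + dist c b" by (rule dist_triangle)
    finally show "dist x y \<le> dist x z + dist y z + e" using b c sym[of z y] by linarith
  qed
qed (simp_all add: uniformity_torus_def open_torus_def)

end

lemma continuous_on_to_torus: "continuous_on A to_torus"
  unfolding continuous_on_iff
proof (intro ballI allI impI)
  fix x and e :: real assume "e > 0"
  then show "\<exists>d>0. \<forall>x'\<in>A. dist x' x < d \<longrightarrow> dist (to_torus x') (to_torus x) < e"
    by (intro exI[of _ e] conjI ballI impI) (auto intro: le_less_trans[OF dist_to_torus_le])
qed

lemma open_torus_iff: "open U \<longleftrightarrow> open (to_torus -` U)"
proof
  assume "open U"
  then show "open (to_torus -` U)"
    by (rule open_vimage) (rule continuous_on_to_torus)
next
  assume o: "open (to_torus -` U)"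
  show "open U"
    unfolding open_dist
  proof
    fix x assume "x \<in> U"
    obtain a where a: "to_torus a = x" using to_torus_surj by blast
    with \<open>x \<in> U\<close> o obtain e where e: "e > 0" "ball a e \<subseteq> to_torus -` U"
      unfolding open_contains_ball by force
    have "y \<in> U" if "dist y x < e" for y
    proof -
      have "dist (to_torus a) y < e" using that a by (simp add: dist_commute)
      then obtain b where "to_torus b = y" "dist a b < e" by (rule dist_torus_lessE)
      then show ?thesis using e(2) by (auto simp: subset_iff)
    qed
    then show "\<exists>e>0. \<forall>y. dist y x < e \<longrightarrow> y \<in> U" using e(1) by (intro exI[of _ e]) simp
  qed
qed

lemma measurable_to_torus [measurable]: "to_torus \<in> borel_measurable borel"
  by (rule borel_measurable_continuous_onI) (rule continuous_on_to_torus)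

definition torus_lebesgue :: "'n::finite torus measure" where
  "torus_lebesgue = distr (restrict_space lborel {x. \<forall>i. 0 \<le> x $ i \<and> x $ i < 1}) borel to_torus"

section \<open>Laplace eigenspaces and the trace inequality\<close>

lift_definition torus_char :: "int ^ 'n \<Rightarrow> 'n::finite torus \<Rightarrow> complex"
  is "\<lambda>k x. exp (2 * of_real pi * \<i> * of_real (int_vec k \<bullet> x))"
proof -
  fix k :: "int ^ 'n" and x y :: "real ^ 'n"
  assume "lattice_rel x y"
  then obtain l where l: "x = y + int_vec l"
    unfolding lattice_rel_def by (auto simp: algebra_simps)
  have "int_vec k \<bullet> x = int_vec k \<bullet> y + real_of_int (\<Sum>i\<in>UNIV. k $ i * l $ i)"
    unfolding l by (simp add: inner_add_right) (simp add: inner_vec_def)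
  then show "exp (2 * of_real pi * \<i> * of_real (int_vec k \<bullet> x)) =
      exp (2 * of_real pi * \<i> * of_real (int_vec k \<bullet> y))"
    unfolding exp_eq by (intro exI[of _ "\<Sum>i\<in>UNIV. k $ i * l $ i"]) (simp add: algebra_simps)
qed

definition lattice_sphere :: "real \<Rightarrow> (int ^ 'n::finite) set" where
  "lattice_sphere lam = {k. norm (int_vec k) = lam}"

lemma finite_lattice_sphere: "finite (lattice_sphere lam)"
proof -
  let ?B = "{- \<lceil>lam\<rceil>..\<lceil>lam\<rceil>}"
  have "lattice_sphere lam \<subseteq> {k :: int ^ 'n. \<forall>i. k $ i \<in> ?B}"
  proof clarify
    fix k :: "int ^ 'n" and i assume k: "k \<in> lattice_sphere lam"
    have "\<bar>real_of_int (k $ i)\<bar> \<le> lam"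
      using component_le_norm_cart[of "int_vec k" i] k by (simp add: lattice_sphere_def)
    then show "k $ i \<in> ?B" by (auto simp: abs_le_iff) linarith+
  qed
  moreover have "{k :: int ^ 'n. \<forall>i. k $ i \<in> ?B} \<subseteq> vec_lambda ` (UNIV \<rightarrow>\<^sub>E ?B)"
    by (auto simp: image_iff PiE_iff intro!: bexI[of _ "vec_nth _"])
  then have "finite {k :: int ^ 'n. \<forall>i. k $ i \<in> ?B}"
    by (rule finite_subset) (intro finite_imageI finite_PiE; simp)
  ultimately show ?thesis by (rule finite_subset)
qed

definition eigenspace :: "real \<Rightarrow> ('n::finite torus \<Rightarrow> complex) set" where
  "eigenspace lam = {u. \<exists>c. u = (\<lambda>x. \<Sum>k\<in>lattice_sphere lam. c k * torus_char k x)}"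

definition sqrt_nats :: "real set" where
  "sqrt_nats = range (\<lambda>n :: nat. sqrt (real n))"

definition trace_inequality :: "'n::finite torus measure \<Rightarrow> bool" where
  "trace_inequality \<mu> \<longleftrightarrow>
     (\<exists>C :: real. \<forall>u \<in> (\<Union>lam\<in>sqrt_nats. eigenspace lam).
        (\<integral>\<^sup>+x. ennreal ((cmod (u x))\<^sup>2) \<partial>\<mu>)
          \<le> ennreal C * (\<integral>\<^sup>+x. ennreal ((cmod (u x))\<^sup>2) \<partial>torus_lebesgue))"

section \<open>Regularity, support and Hausdorff dimension\<close>

definition upper_regular :: "real \<Rightarrow> 'a::metric_space measure \<Rightarrow> bool" where
  "upper_regular \<alpha> \<mu> \<longleftrightarrow>
     (\<exists>C :: real. \<forall>x. \<forall>r\<in>{0<..<1}. emeasure \<mu> (ball x r) \<le> ennreal (C * r powr \<alpha>))"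

definition measure_support :: "'a::topological_space measure \<Rightarrow> 'a set" where
  "measure_support \<mu> = {x. \<forall>U. open U \<and> x \<in> U \<longrightarrow> emeasure \<mu> U > 0}"

text \<open>
  The term of a covering set in the Hausdorff sums.  The cases reflect the conventions
  \<open>diam(U)\<^sup>0 = 1\<close> for nonempty \<open>U\<close>, whereas \<open>0 powr 0 = 0\<close>, and \<open>0\<close> for empty \<open>U\<close>.
\<close>

definition hausdorff_gauge :: "real \<Rightarrow> 'a::metric_space set \<Rightarrow> ennreal" where
  "hausdorff_gauge s U =
     (if U = {} then 0 else if s = 0 then 1 else ennreal (diameter U powr s))"

definition hausdorff_content :: "real \<Rightarrow> real \<Rightarrow> 'a::metric_space set \<Rightarrow> ennreal" where
  "hausdorff_content s \<delta> A =
     (INF U \<in> {U :: nat \<Rightarrow> 'a set. A \<subseteq> (\<Union>i. U i) \<and> (\<forall>i. bounded (U i) \<and> diameter (U i) \<le> \<delta>)}.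
        \<Sum>i. hausdorff_gauge s (U i))"

definition hausdorff_measure :: "real \<Rightarrow> 'a::metric_space set \<Rightarrow> ennreal" where
  "hausdorff_measure s A = (SUP \<delta>\<in>{0<..}. hausdorff_content s \<delta> A)"

definition hausdorff_dim :: "'a::metric_space set \<Rightarrow> ennreal" where
  "hausdorff_dim A = (INF s \<in> {s. s \<ge> 0 \<and> hausdorff_measure s A = 0}. ennreal s)"

end

theory Submission
  imports Defs
begin

text \<open>
  Write \<open>d\<close> for the dimension.  The trace inequality is tested on the zonal kernel
  \<open>u(x) = \<Sum> e(k \<bullet> (x - x0))\<close>, where \<open>e(t) = exp (2 \<pi> \<i> t)\<close> and \<open>k\<close> runs
  over the \<open>N\<close> lattice points on the sphere of radius \<open>lam\<close>.  By Parseval (\<open>parseval_torus\<close>) its squared \<open>L\<^sup>2\<close> norm is \<open>N\<close>, whereas on a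
  ball of radius \<open>r \<le> 1 / (6 lam)\<close> around \<open>x0\<close> all \<open>N\<close> terms point in roughly the same direction,
  so that \<open>\<bar>u\<bar> \<ge> N / 2\<close> there.  Hence \<open>N\<^sup>2 \<mu>(ball x0 r) / 4 \<le> C N\<close>, that is,
  \<open>\<mu>(ball x0 r) \<le> 4 C / N\<close> (\<open>trace_bound_ball\<close>).

  It remains to find a sphere of radius at most \<open>R = 1 / (6 r)\<close> with \<open>N\<close> at least a constant times
  \<open>R\<^sup>d\<^sup>-\<^sup>2\<close>.  The number of lattice points on an individual sphere is a delicate arithmetic
  quantity in low dimension, but the radius is free: the order of \<open>R\<^sup>d\<close> lattice points of norm at
  most \<open>R\<close> lie on at most \<open>R\<^sup>2 + 1\<close> spheres, so some sphere has the average number of points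
  (\<open>exists_rich_lattice_sphere\<close>).  This gives the upper \<open>(d-2)\<close>-regularity.

  The statement on the dimension is the mass distribution principle: each covering set lies in a
  closed ball with radius its diameter, so regularity bounds the Hausdorff sums below by a constant
  times the measure of the covered set (\<open>hausdorff_dim_ge_of_upper_regular\<close>).  The support has
  full measure because its complement is a union of open null sets, which the Lindelof property of
  \<open>\<real>\<^sup>d\<close> reduces to a countable one.
\<close>

section \<open>Orthogonality of the characters\<close>

lemma torus_char_to_torus:
  "torus_char k (to_torus x) = exp (2 * of_real pi * \<i> * of_real (int_vec k \<bullet> x))"
  by (rule torus_char.abs_eq)

lemma torus_char_eq_cis: "torus_char k (to_torus x) = cis (2 * pi * (int_vec k \<bullet> x))"
  by (simp add: torus_char_to_torus cis_conv_exp algebra_simps)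

lemma torus_char_mult_cnj:
  "torus_char k x * cnj (torus_char l x) = torus_char (k - l) x"
proof -
  obtain a where a: "x = to_torus a" using to_torus_surj by metis
  show ?thesis
    by (simp add: a torus_char_eq_cis cis_cnj cis_mult inner_diff_left algebra_simps)
qed

lemma norm_torus_char: "cmod (torus_char k x) = 1"
  using to_torus_surj[of x] by (auto simp: torus_char_eq_cis)

text \<open>The topology of the torus is the quotient topology, so continuity can be checked on lifts.\<close>

lemma continuous_on_torusI:
  fixes f :: "'n::finite torus \<Rightarrow> 'b::topological_space"
  assumes "continuous_on UNIV (\<lambda>x. f (to_torus x))"
  shows "continuous_on UNIV f"
proof -
  have "open (f -` B)" if "open B" for B
    using open_vimage[OF that assms] by (simp add: open_torus_iff vimage_def)
  then show ?thesis by (simp add: continuous_on_open_vimage)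
qed

lemma measurable_torus_char [measurable]: "torus_char k \<in> borel_measurable borel"
  by (intro borel_measurable_continuous_onI continuous_on_torusI)
     (auto simp: torus_char_to_torus intro!: continuous_intros)

lemma prob_space_torus_lebesgue: "prob_space (torus_lebesgue :: 'n::finite torus measure)"
proof -
  let ?Q = "{x :: real ^ 'n. \<forall>i. 0 \<le> x $ i \<and> x $ i < 1}"
  have Q: "?Q = {x. \<forall>b\<in>Basis. 0 \<le> x \<bullet> b \<and> x \<bullet> b < 1}"
    by (auto simp: Basis_vec_def inner_axis)
  have [measurable]: "?Q \<in> sets borel" by measurable
  have ind: "indicator ?Q x = (\<Prod>b\<in>Basis. indicator {0..<1::real} (x \<bullet> b) :: ennreal)"
    for x :: "real ^ 'n"
  proof (cases "x \<in> ?Q")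
    case False
    then obtain b :: "real ^ 'n" where "b \<in> Basis" "indicator {0..<1::real} (x \<bullet> b) = (0::ennreal)"
      unfolding Q by auto
    then have "(\<Prod>b\<in>Basis. indicator {0..<1::real} (x \<bullet> b) :: ennreal) = 0"
      by (intro prod_zero) auto
    then show ?thesis using False by simp
  qed (simp add: Q)
  have "emeasure lborel ?Q
      = (\<integral>\<^sup>+x. (\<Prod>b\<in>Basis. indicator {0..<1::real} (x \<bullet> b)) \<partial>(lborel :: (real ^ 'n) measure))"
    by (simp only: ind[symmetric]) simp
  also have "\<dots> = 1"
    using nn_integral_lborel_prod[of "\<lambda>_. indicator {0..<1::real}"]
    by simp
  finally have "emeasure lborel ?Q = 1" .
  then have "prob_space (restrict_space lborel ?Q)"
    by (intro prob_spaceI) (simp add: emeasure_restrict_space space_restrict_space)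
  then show ?thesis
    unfolding torus_lebesgue_def
    by (rule prob_space.prob_space_distr) (intro measurable_restrict_space1; measurable)
qed

lemma integral_unit_circle_char:
  fixes m :: int
  assumes "m \<noteq> 0"
  shows "(\<integral>t. indicator {0..<1::real} t *\<^sub>R cis (2 * pi * (t * of_int m)) \<partial>lborel) = 0"
proof -
  define w :: complex where "w = 2 * of_real pi * \<i> * of_int m"
  have w: "w \<noteq> 0" using assms by (simp add: w_def)
  have cis: "cis (2 * pi * (t * of_int m)) = exp (w * of_real t)" for t
    by (simp add: cis_conv_exp w_def algebra_simps)
  have "(\<integral>t. indicator {0..<1::real} t *\<^sub>R exp (w * of_real t) \<partial>lborel)
      = (\<integral>t. indicator {0..1::real} t *\<^sub>R exp (w * of_real t) \<partial>lborel)"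
    by (intro integral_cong_AE eventually_mono[OF AE_lborel_singleton[of 1]])
       (auto simp: indicator_def)
  also have "\<dots> = exp (w * of_real 1) / w - exp (w * of_real 0) / w"
  proof (rule integral_FTC_atLeastAtMost)
    show "((\<lambda>t. exp (w * of_real t) / w) has_vector_derivative exp (w * of_real t))
        (at t within {0..1})" for t
      using w by (auto intro!: derivative_eq_intros has_vector_derivative_real_field
          simp: field_simps)
  qed (auto intro!: continuous_intros)
  also have "exp (w * of_real 1) = 1"
    using exp_integer_2pi[of "of_int m"] by (simp add: w_def mult_ac)
  finally show ?thesis by (simp add: cis)
qed

text \<open>
  Over the unit cube the character splits into a product of one-dimensional characters, and
  Fubini turns its integral into a product of integrals over \<open>[0, 1)\<close>.  A coordinate in which \<open>k\<close>
  does not vanish contributes a full number of turns of the unit circle, hence a factor 0.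
\<close>

lemma integral_torus_char_eq_0:
  fixes k :: "int ^ 'n::finite"
  assumes "k \<noteq> 0"
  shows "(\<integral>x. torus_char k x \<partial>torus_lebesgue) = 0"
proof -
  let ?Q = "{x :: real ^ 'n. \<forall>i. 0 \<le> x $ i \<and> x $ i < 1}"
  let ?g = "\<lambda>b t. indicator {0..<1::real} t *\<^sub>R cis (2 * pi * (t * (int_vec k \<bullet> b)))"
  have Q: "?Q = {x. \<forall>b\<in>Basis. 0 \<le> x \<bullet> b \<and> x \<bullet> b < 1}"
    by (auto simp: Basis_vec_def inner_axis)
  have [measurable]: "?Q \<in> sets borel" by measurable
  have cis_m [measurable]: "cis \<in> borel_measurable borel"
    by (intro borel_measurable_continuous_onI continuous_intros)
  obtain i where i: "k $ i \<noteq> 0" using assms by (auto simp: vec_eq_iff)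
  interpret product_sigma_finite "\<lambda>_ :: real ^ 'n. lborel :: real measure" ..
  have split: "indicator ?Q x *\<^sub>R torus_char k (to_torus x) = (\<Prod>b\<in>Basis. ?g b (x \<bullet> b))"
    for x :: "real ^ 'n"
  proof (cases "x \<in> ?Q")
    case True
    have "int_vec k \<bullet> x = (\<Sum>b\<in>Basis. (x \<bullet> b) * (int_vec k \<bullet> b))"
      by (subst euclidean_inner) (simp add: mult.commute)
    then have "torus_char k (to_torus x) = (\<Prod>b\<in>Basis. cis (2 * pi * ((x \<bullet> b) * (int_vec k \<bullet> b))))"
      by (simp add: torus_char_to_torus cis_conv_exp exp_sum[symmetric] sum_distrib_left mult_ac)
    then show ?thesis using True unfolding Q by simp
  next
    case False
    then obtain b :: "real ^ 'n" where "b \<in> Basis" "?g b (x \<bullet> b) = 0" unfolding Q by auto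
    then have "(\<Prod>b\<in>Basis. ?g b (x \<bullet> b)) = 0" by (intro prod_zero) auto
    then show ?thesis using False by simp
  qed
  have int: "integrable lborel (?g b)" for b
    by (intro Bochner_Integration.integrable_bound[OF integrable_real_indicator[of "{0..<1::real}" lborel]])
       (auto simp: indicator_def)
  have "(\<integral>x. torus_char k x \<partial>torus_lebesgue)
      = (\<integral>x. indicator ?Q x *\<^sub>R torus_char k (to_torus x) \<partial>lborel)"
    unfolding torus_lebesgue_def
    by (subst integral_distr) (simp_all add: integral_restrict_space measurable_restrict_space1)
  also have "\<dots> = (\<integral>x. (\<Prod>b\<in>Basis. ?g b (x \<bullet> b)) \<partial>lborel)"
    by (simp only: split)
  also have "\<dots> = (\<integral>f. (\<Prod>b\<in>Basis. ?g b (f b)) \<partial>(\<Pi>\<^sub>M b\<in>(Basis :: (real ^ 'n) set). lborel))"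
    by (subst lborel_eq, subst integral_distr) (simp_all)
  also have "\<dots> = (\<Prod>b\<in>Basis. \<integral>t. ?g b t \<partial>lborel)"
    by (rule product_integral_prod) (simp_all add: int)
  also have "\<dots> = 0"
  proof (rule prod_zero)
    have "axis i 1 \<in> (Basis :: (real ^ 'n) set)" by (simp add: axis_in_Basis_iff)
    then show "\<exists>b\<in>Basis. (\<integral>t. ?g b t \<partial>lborel) = 0"
      using integral_unit_circle_char[OF i] by (intro bexI[of _ "axis i 1"]) (simp_all add: inner_axis)
  qed simp
  finally show ?thesis .
qed

lemma parseval_torus:
  fixes K :: "(int ^ 'n::finite) set"
  assumes "finite K"
  shows "(\<integral>\<^sup>+x. ennreal ((cmod (\<Sum>k\<in>K. c k * torus_char k x))\<^sup>2) \<partial>torus_lebesgue)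
    = ennreal (\<Sum>k\<in>K. (cmod (c k))\<^sup>2)"
proof -
  interpret prob_space "torus_lebesgue :: 'n torus measure" by (rule prob_space_torus_lebesgue)
  have sets: "sets (torus_lebesgue :: 'n torus measure) = sets borel"
    by (simp add: torus_lebesgue_def)
  note [measurable_cong] = sets
  let ?u = "\<lambda>x. \<Sum>k\<in>K. c k * torus_char k x"
  have int: "integrable torus_lebesgue (torus_char k)" for k :: "int ^ 'n"
    by (rule integrable_const_bound[of _ 1]) (simp_all add: norm_torus_char)
  have ort: "(\<integral>x. torus_char (k - l) x \<partial>torus_lebesgue) = (if k = l then 1 else 0)"
    for k l :: "int ^ 'n"
  proof (cases "k = l")
    case True
    have "torus_char 0 x = 1" for x :: "'n torus"
      using to_torus_surj[of x] by (auto simp: torus_char_eq_cis)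
    then show ?thesis using True prob_space by simp
  qed (simp add: integral_torus_char_eq_0)
  have expand: "complex_of_real ((cmod (?u x))\<^sup>2)
      = (\<Sum>k\<in>K. \<Sum>l\<in>K. (c k * cnj (c l)) * torus_char (k - l) x)" for x
    by (simp only: complex_norm_square cnj_sum sum_product complex_cnj_mult
        torus_char_mult_cnj[symmetric] mult_ac)
  have intu: "integrable torus_lebesgue (\<lambda>x. (cmod (?u x))\<^sup>2)"
    by (rule integrable_const_bound[of _ "(\<Sum>k\<in>K. cmod (c k))\<^sup>2"])
       (auto intro!: power_mono sum_norm_le simp: norm_mult norm_torus_char)
  have "complex_of_real (\<integral>x. (cmod (?u x))\<^sup>2 \<partial>torus_lebesgue)
      = (\<integral>x. (\<Sum>k\<in>K. \<Sum>l\<in>K. (c k * cnj (c l)) * torus_char (k - l) x) \<partial>torus_lebesgue)"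
    by (simp only: integral_complex_of_real[symmetric] expand)
  also have "\<dots> = (\<Sum>k\<in>K. \<Sum>l\<in>K. (c k * cnj (c l)) * (if k = l then 1 else 0))"
    by (simp add: int ort)
  also have "\<dots> = complex_of_real (\<Sum>k\<in>K. (cmod (c k))\<^sup>2)"
    using assms by (simp add: complex_norm_square if_distrib del: of_real_power cong: if_cong)
  finally have "(\<integral>x. (cmod (?u x))\<^sup>2 \<partial>torus_lebesgue) = (\<Sum>k\<in>K. (cmod (c k))\<^sup>2)"
    by (simp only: of_real_eq_iff)
  then show ?thesis
    using nn_integral_eq_integral[OF intu] by simp
qed

section \<open>Spheres with many lattice points\<close>

text \<open>
  Pigeonhole: the cube \<open>{0..m}\<^sup>d\<close> with \<open>m = \<lfloor>R / d\<rfloor>\<close> has at least \<open>(R / d)\<^sup>d\<close> lattice points, all of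
  norm at most \<open>R\<close> because the norm is at most the sum of the coordinates.  Squared norms of lattice
  points are natural numbers, so these points lie on at most \<open>R\<^sup>2 + 1\<close> spheres.
\<close>

lemma exists_rich_lattice_sphere:
  fixes R :: real
  assumes "R > 0"
  shows "\<exists>n. real n \<le> R\<^sup>2 \<and>
    (R / CARD('n)) ^ CARD('n) \<le> (R\<^sup>2 + 1) * card (lattice_sphere (sqrt (real n)) :: (int ^ 'n::finite) set)"
proof -
  let ?d = "CARD('n)"
  let ?S = "\<lambda>n :: nat. lattice_sphere (sqrt (real n)) :: (int ^ 'n) set"
  define m where "m = \<lfloor>R / ?d\<rfloor>"
  define N where "N = nat \<lfloor>R\<^sup>2\<rfloor>"
  define G :: "(int ^ 'n) set" where "G = vec_lambda ` (UNIV \<rightarrow>\<^sub>E {0..m})"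
  have m0: "m \<ge> 0" using assms by (simp add: m_def)
  have cardG: "card G = (nat (m + 1)) ^ ?d"
  proof -
    have "inj_on vec_lambda (UNIV \<rightarrow>\<^sub>E {0..m} :: ('n \<Rightarrow> int) set)"
      by (auto simp: inj_on_def vec_lambda_inject)
    then have "card G = card (UNIV \<rightarrow>\<^sub>E {0..m} :: ('n \<Rightarrow> int) set)"
      unfolding G_def by (rule card_image)
    then show ?thesis by (simp add: card_PiE)
  qed
  have "R / ?d \<le> real (nat (m + 1))" using m0 unfolding m_def by linarith
  then have A: "(R / ?d) ^ ?d \<le> real (card G)"
    unfolding cardG using assms by (simp add: power_mono)
  have "G \<subseteq> (\<Union>n\<le>N. ?S n)"
  proof
    fix k assume "k \<in> G"
    then have k: "0 \<le> k $ i" "k $ i \<le> m" for i by (auto simp: G_def PiE_iff)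
    define s where "s = nat (\<Sum>i\<in>UNIV. (k $ i)\<^sup>2)"
    have s: "real s = (\<Sum>i\<in>UNIV. (real_of_int (k $ i))\<^sup>2)"
      by (simp add: s_def sum_nonneg)
    then have norm: "norm (int_vec k) = sqrt (real s)"
      by (simp add: norm_vec_def L2_set_def)
    have "norm (int_vec k) \<le> (\<Sum>i\<in>UNIV. \<bar>int_vec k $ i\<bar>)" by (rule norm_le_l1_cart)
    also have "\<dots> \<le> (\<Sum>i\<in>(UNIV :: 'n set). R / ?d)"
    proof (rule sum_mono)
      fix i
      have "real_of_int (k $ i) \<le> real_of_int m" using k by simp
      also have "\<dots> \<le> R / ?d" unfolding m_def by linarith
      finally show "\<bar>int_vec k $ i\<bar> \<le> R / ?d" using k(1)[of i] by simp
    qed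
    also have "\<dots> = R" by simp
    finally have "real s \<le> R\<^sup>2" using assms unfolding norm
      by (metis of_nat_0_le_iff real_sqrt_ge_0_iff power_mono real_sqrt_pow2)
    then have "s \<le> N" by (simp add: N_def le_nat_floor)
    then show "k \<in> (\<Union>n\<le>N. ?S n)" using norm by (auto simp: lattice_sphere_def)
  qed
  then have "card G \<le> card (\<Union>n\<le>N. ?S n)"
    by (intro card_mono finite_UN_I finite_lattice_sphere) auto
  also have "\<dots> \<le> (\<Sum>n\<le>N. card (?S n))" by (rule card_UN_le) simp
  finally have B: "real (card G) \<le> (\<Sum>n\<le>N. real (card (?S n)))"
    by (metis of_nat_le_iff of_nat_sum)
  have NR: "real N \<le> R\<^sup>2" by (simp add: N_def)
  have "\<exists>n\<le>N. (R / ?d) ^ ?d \<le> (R\<^sup>2 + 1) * card (?S n)"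
  proof (rule ccontr)
    assume "\<not> ?thesis"
    then have "(R\<^sup>2 + 1) * card (?S n) < (R / ?d) ^ ?d" if "n \<le> N" for n using that by force
    then have "(\<Sum>n\<le>N. (R\<^sup>2 + 1) * card (?S n)) < (\<Sum>n\<le>N. (R / ?d) ^ ?d)"
      by (intro sum_strict_mono) auto
    also have "\<dots> = (real N + 1) * (R / ?d) ^ ?d" by simp
    also have "\<dots> \<le> (R\<^sup>2 + 1) * (R / ?d) ^ ?d"
      using NR assms by (intro mult_right_mono) auto
    also have "\<dots> \<le> (R\<^sup>2 + 1) * (\<Sum>n\<le>N. real (card (?S n)))"
      using A B by (intro mult_left_mono) auto
    finally show False by (simp add: sum_distrib_left)
  qed
  then obtain n where "n \<le> N" "(R / ?d) ^ ?d \<le> (R\<^sup>2 + 1) * card (?S n)" by blast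
  then show ?thesis using NR by (intro exI[of _ n]) auto
qed

section \<open>Testing the trace inequality on zonal kernels\<close>

text \<open>
  The threshold \<open>1 / 6\<close> keeps every phase \<open>2 \<pi> k \<bullet> (x - x0)\<close> within \<open>\<pi> / 3\<close> of 0, so every
  term has real part at least \<open>cos (\<pi> / 3) = 1 / 2\<close> and no cancellation occurs.
\<close>

lemma zonal_kernel_ge:
  fixes x0 x :: "'n::finite torus"
  assumes "x \<in> ball x0 r" "lam * r \<le> 1 / 6"
  shows "card (lattice_sphere lam :: (int ^ 'n) set) / 2
    \<le> cmod (\<Sum>k\<in>lattice_sphere lam. cnj (torus_char k x0) * torus_char k x)"
proof -
  let ?S = "lattice_sphere lam :: (int ^ 'n) set"
  obtain a where a: "to_torus a = x0" using to_torus_surj by blast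
  have "dist (to_torus a) x < r" using assms(1) a by simp
  then obtain b where b: "to_torus b = x" "dist a b < r" by (rule dist_torus_lessE)
  have re: "1 / 2 \<le> Re (cnj (torus_char k x0) * torus_char k x)" if "k \<in> ?S" for k
  proof -
    let ?t = "int_vec k \<bullet> (b - a)"
    have "\<bar>?t\<bar> \<le> norm (int_vec k) * norm (b - a)" by (rule Cauchy_Schwarz_ineq2)
    also have "\<dots> \<le> lam * r"
      using that b(2) norm_ge_zero[of "int_vec k"]
      by (intro mult_mono) (auto simp: lattice_sphere_def dist_norm norm_minus_commute)
    finally have "\<bar>?t\<bar> \<le> 1 / 6" using assms(2) by linarith
    then have "2 * pi * \<bar>?t\<bar> \<le> pi / 3" by simp
    then have "cos (pi / 3) \<le> cos (2 * pi * \<bar>?t\<bar>)"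
      using pi_gt_zero by (intro cos_monotone_0_pi_le) auto
    also have "\<dots> = cos (2 * pi * ?t)"
      by (metis abs_mult abs_of_pos cos_abs_real mult_pos_pos pi_gt_zero zero_less_numeral)
    also have "\<dots> = Re (cnj (torus_char k x0) * torus_char k x)"
      unfolding a[symmetric] b(1)[symmetric] torus_char_eq_cis cis_cnj cis_mult
      by (simp add: inner_diff_right algebra_simps)
    finally show ?thesis by (simp add: cos_60)
  qed
  have "card ?S / 2 = (\<Sum>k\<in>?S. 1 / 2)" by simp
  also have "\<dots> \<le> (\<Sum>k\<in>?S. Re (cnj (torus_char k x0) * torus_char k x))"
    using re by (rule sum_mono)
  also have "\<dots> = Re (\<Sum>k\<in>?S. cnj (torus_char k x0) * torus_char k x)" by simp
  also have "\<dots> \<le> cmod (\<Sum>k\<in>?S. cnj (torus_char k x0) * torus_char k x)"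
    by (rule complex_Re_le_cmod)
  finally show ?thesis .
qed

text \<open>
  The kernel is at least \<open>N / 2\<close> on the ball while its squared \<open>L\<^sup>2\<close> norm is only \<open>N\<close>, where \<open>N\<close>
  counts the lattice points of the sphere; dividing the trace inequality by \<open>N\<close> gives the bound.
\<close>

lemma trace_bound_ball:
  fixes \<mu> :: "'n::finite torus measure"
  assumes sets: "sets \<mu> = sets borel"
    and "C \<ge> 0"
    and trace: "\<And>u. u \<in> eigenspace lam \<Longrightarrow> (\<integral>\<^sup>+x. ennreal ((cmod (u x))\<^sup>2) \<partial>\<mu>)
          \<le> ennreal C * (\<integral>\<^sup>+x. ennreal ((cmod (u x))\<^sup>2) \<partial>torus_lebesgue)"
    and "lam * r \<le> 1 / 6"
  shows "ennreal (card (lattice_sphere lam :: (int ^ 'n) set) / 4) * emeasure \<mu> (ball x0 r) \<le> ennreal C"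
proof -
  let ?S = "lattice_sphere lam :: (int ^ 'n) set"
  define N where "N = real (card ?S)"
  define u where "u = (\<lambda>x. \<Sum>k\<in>?S. cnj (torus_char k x0) * torus_char k x)"
  have u: "u \<in> eigenspace lam" unfolding u_def eigenspace_def by auto
  have "ennreal ((N / 2)\<^sup>2) * emeasure \<mu> (ball x0 r)
      = (\<integral>\<^sup>+x. ennreal ((N / 2)\<^sup>2) * indicator (ball x0 r) x \<partial>\<mu>)"
    by (rule nn_integral_cmult_indicator[symmetric]) (simp add: sets)
  also have "\<dots> \<le> (\<integral>\<^sup>+x. ennreal ((cmod (u x))\<^sup>2) \<partial>\<mu>)"
  proof (rule nn_integral_mono)
    fix x
    have "x \<in> ball x0 r \<Longrightarrow> (N / 2)\<^sup>2 \<le> (cmod (u x))\<^sup>2"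
      using zonal_kernel_ge[OF _ assms(4), of x x0] unfolding N_def u_def by (intro power_mono) auto
    then show "ennreal ((N / 2)\<^sup>2) * indicator (ball x0 r) x \<le> ennreal ((cmod (u x))\<^sup>2)"
      by (auto simp: indicator_def intro: ennreal_leI)
  qed
  also have "\<dots> \<le> ennreal C * (\<integral>\<^sup>+x. ennreal ((cmod (u x))\<^sup>2) \<partial>torus_lebesgue)"
    by (rule trace[OF u])
  also have "\<dots> = ennreal C * ennreal N"
    unfolding u_def by (subst parseval_torus[OF finite_lattice_sphere]) (simp add: norm_torus_char N_def)
  finally have le: "ennreal N * (ennreal (N / 4) * emeasure \<mu> (ball x0 r)) \<le> ennreal N * ennreal C"
    by (simp add: power2_eq_square mult.assoc[symmetric] ennreal_mult[symmetric] N_def mult.commute)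
  show ?thesis
  proof (cases "N = 0")
    case False
    then have "N > 0" by (simp add: N_def)
    then show ?thesis using le unfolding N_def[symmetric]
      by (subst (asm) ennreal_mult_le_mult_iff) auto
  qed (simp add: N_def[symmetric])
qed

text \<open>
  The frequency scale is matched to the ball, \<open>R = 1 / (6 r)\<close>, and the sphere is a richest one of
  radius at most \<open>R\<close>.  The exponent \<open>d - 2\<close> comes from \<open>R\<^sup>d\<close> lattice points shared among about
  \<open>R\<^sup>2\<close> spheres.
\<close>

lemma upper_regular_of_trace_inequality:
  fixes \<mu> :: "'n::finite torus measure"
  assumes "prob_space \<mu>" and sets: "sets \<mu> = sets borel" and "trace_inequality \<mu>"
  shows "upper_regular (real CARD('n) - 2) \<mu>"
proof -
  interpret prob_space \<mu> by fact
  let ?d = "CARD('n)"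
  obtain C0 where C0: "\<And>u lam. lam \<in> sqrt_nats \<Longrightarrow> u \<in> eigenspace lam \<Longrightarrow>
      (\<integral>\<^sup>+x. ennreal ((cmod (u x))\<^sup>2) \<partial>\<mu>)
        \<le> ennreal C0 * (\<integral>\<^sup>+x. ennreal ((cmod (u x))\<^sup>2) \<partial>torus_lebesgue)"
    using assms(3) unfolding trace_inequality_def by blast
  define C where "C = max C0 0"
  have C: "C \<ge> 0" "ennreal C0 = ennreal C" by (simp_all add: C_def max_def ennreal_neg)
  have "emeasure \<mu> (ball x r) \<le> ennreal (8 * C * (6 * ?d) ^ ?d * r powr (real ?d - 2))"
    if r: "r \<in> {0<..<1}" for x :: "'n torus" and r
  proof -
    define R where "R = 1 / (6 * r)"
    have R: "R > 0" "R * r = 1 / 6" using r by (simp_all add: R_def)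
    obtain n where n: "real n \<le> R\<^sup>2"
      "(R / ?d) ^ ?d \<le> (R\<^sup>2 + 1) * card (lattice_sphere (sqrt (real n)) :: (int ^ 'n) set)"
      using exists_rich_lattice_sphere[OF R(1), where 'n='n] by blast
    define N where "N = real (card (lattice_sphere (sqrt (real n)) :: (int ^ 'n) set))"
    have "sqrt (real n) \<le> R" using n(1) R(1) by (simp add: real_le_lsqrt)
    then have lam: "sqrt (real n) * r \<le> 1 / 6"
      using mult_right_mono[of "sqrt (real n)" R r] R(2) r by simp
    have "ennreal (N / 4) * emeasure \<mu> (ball x r) \<le> ennreal C"
      unfolding N_def
      by (rule trace_bound_ball[OF sets C(1) _ lam], unfold C(2)[symmetric], rule C0)
         (auto simp: sqrt_nats_def)
    then have Nm: "N / 4 * measure \<mu> (ball x r) \<le> C"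
      using C(1) by (simp add: emeasure_eq_measure ennreal_mult[symmetric] N_def)
    \<comment> \<open>Since \<open>r < 1\<close>, the additive 1 in the count of spheres is absorbed by \<open>1 / r\<^sup>2\<close>.\<close>
    have "R\<^sup>2 + 1 \<le> 2 / r\<^sup>2"
    proof -
      have "r\<^sup>2 \<le> 1" using r by (simp add: power_le_one)
      then have "1 \<le> 1 / r\<^sup>2" using r by (simp add: field_simps)
      moreover have "R\<^sup>2 = (1 / 36) * (1 / r\<^sup>2)" by (simp add: R_def power_divide power_mult_distrib)
      ultimately show ?thesis by simp
    qed
    then have "(R / ?d) ^ ?d \<le> 2 / r\<^sup>2 * N"
      using n(2) mult_right_mono[of "R\<^sup>2 + 1" "2 / r\<^sup>2" N] by (simp add: N_def)
    then have "(R / ?d) ^ ?d * (6 * ?d * r) ^ ?d \<le> 2 / r\<^sup>2 * N * (6 * ?d * r) ^ ?d"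
      using r by (intro mult_right_mono) auto
    moreover have "(R / ?d) ^ ?d * (6 * ?d * r) ^ ?d = 1"
      using r by (simp add: power_mult_distrib[symmetric] R_def)
    ultimately have "measure \<mu> (ball x r) * 1
        \<le> measure \<mu> (ball x r) * (2 / r\<^sup>2 * N * (6 * ?d * r) ^ ?d)"
      by (intro mult_left_mono) auto
    also have "\<dots> = (N / 4 * measure \<mu> (ball x r)) * (8 / r\<^sup>2 * (6 * ?d * r) ^ ?d)" by simp
    also have "\<dots> \<le> C * (8 / r\<^sup>2 * (6 * ?d * r) ^ ?d)"
      using Nm r by (intro mult_right_mono) auto
    also have "\<dots> = 8 * C * (6 * ?d) ^ ?d * r powr (real ?d - 2)"
      using r by (simp add: powr_diff powr_realpow power_mult_distrib)
    finally show ?thesis by (simp add: emeasure_eq_measure ennreal_leI)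
  qed
  then show ?thesis unfolding upper_regular_def by (intro exI[of _ "8 * C * (6 * ?d) ^ ?d"]) auto
qed

section \<open>The mass distribution principle\<close>

text \<open>
  Closed balls are approximated by larger open ones.  The radius 0 is the point of the lemma: covering
  sets of diameter 0 contribute nothing to Hausdorff sums of positive order, and positivity of
  \<open>\<alpha>\<close> shows that points are null.
\<close>

lemma emeasure_cball_le:
  fixes \<mu> :: "'a::metric_space measure"
  assumes sets: "sets \<mu> = sets borel"
    and ball: "\<And>x r. r \<in> {0<..<1} \<Longrightarrow> emeasure \<mu> (ball x r) \<le> ennreal (C * r powr \<alpha>)"
    and "\<alpha> > 0" "0 \<le> d" "d < 1"
  shows "emeasure \<mu> (cball x d) \<le> ennreal (C * d powr \<alpha>)"
proof (rule tendsto_lowerbound)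
  show "((\<lambda>r. ennreal (C * r powr \<alpha>)) \<longlongrightarrow> ennreal (C * d powr \<alpha>)) (at_right d)"
    using assms(3,4)
    by (auto intro!: tendsto_intros eventually_mono[OF eventually_at_right_less])
  show "\<forall>\<^sub>F r in at_right d. emeasure \<mu> (cball x d) \<le> ennreal (C * r powr \<alpha>)"
  proof (rule eventually_at_rightI[of d 1])
    fix r assume r: "r \<in> {d<..<1}"
    then have "emeasure \<mu> (cball x d) \<le> emeasure \<mu> (ball x r)"
      by (intro emeasure_mono) (auto simp: sets)
    also have "\<dots> \<le> ennreal (C * r powr \<alpha>)" using r assms(4) by (intro ball) auto
    finally show "emeasure \<mu> (cball x d) \<le> ennreal (C * r powr \<alpha>)" .
  qed fact
qed simp

text \<open>
  If the order \<open>s\<close> is below \<open>\<alpha>\<close>, then on sets of diameter at most \<open>1 / 2\<close> the gauge of order \<open>s\<close>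
  dominates the power \<open>\<alpha>\<close> of the diameter, which in turn dominates the measure up to a constant.
  Covers with small Hausdorff sum would therefore force \<open>A\<close> to be a null set.  Any scale
  below 1 in place of \<open>1 / 2\<close> would do: regularity applies there, and smaller exponents give larger powers.
\<close>

lemma hausdorff_dim_ge_of_upper_regular:
  fixes \<mu> :: "'a::metric_space measure"
  assumes sets: "sets \<mu> = sets borel" and reg: "upper_regular \<alpha> \<mu>" and pos: "emeasure \<mu> A > 0"
  shows "ennreal \<alpha> \<le> hausdorff_dim A"
  unfolding hausdorff_dim_def
proof (rule INF_greatest, clarify)
  fix s :: real assume s: "s \<ge> 0" "hausdorff_measure s A = 0"
  show "ennreal \<alpha> \<le> ennreal s"
  proof (rule ccontr)
    assume "\<not> ?thesis"
    then have sa: "s < \<alpha>" by (meson ennreal_leI not_le)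
    obtain C0 where C0: "emeasure \<mu> (ball x r) \<le> ennreal (C0 * r powr \<alpha>)" if "r \<in> {0<..<1}" for x r
      using reg unfolding upper_regular_def by blast
    define C where "C = max C0 1"
    have C: "C > 0" by (simp add: C_def)
    have ball: "emeasure \<mu> (ball x r) \<le> ennreal (C * r powr \<alpha>)" if "r \<in> {0<..<1}" for x r
      using C0[OF that, of x] by (rule order_trans) (auto simp: C_def intro!: ennreal_leI mult_right_mono)
    have "hausdorff_content s (1/2) A \<le> hausdorff_measure s A"
      unfolding hausdorff_measure_def by (rule SUP_upper) simp
    then have content: "hausdorff_content s (1/2) A = 0" using s(2) by simp
    have "emeasure \<mu> A \<le> 0"
    proof (rule ennreal_le_epsilon)
      fix e :: real assume e: "e > 0"
      then have "hausdorff_content s (1/2) A < ennreal (e / C)" using content C by simp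
      then obtain U where U: "A \<subseteq> (\<Union>i. U i)" "\<And>i. bounded (U i)" "\<And>i. diameter (U i) \<le> 1/2"
        "(\<Sum>i. hausdorff_gauge s (U i)) < ennreal (e / C)"
        unfolding hausdorff_content_def INF_less_iff by blast
      \<comment> \<open>The sets \<open>U i\<close> need not be measurable, so they are enlarged to closed balls.\<close>
      define B where "B i = (if U i = {} then {} else cball (SOME x. x \<in> U i) (diameter (U i)))" for i
      have B_sets: "B i \<in> sets \<mu>" for i by (simp add: B_def sets)
      have UB: "U i \<subseteq> B i" for i
      proof
        fix x assume x: "x \<in> U i"
        then have "(SOME x. x \<in> U i) \<in> U i" by (rule someI)
        then have "dist (SOME x. x \<in> U i) x \<le> diameter (U i)"
          using U(2) x by (intro diameter_bounded_bound)
        then show "x \<in> B i" using x by (auto simp: B_def)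
      qed
      have B_le: "emeasure \<mu> (B i) \<le> ennreal C * hausdorff_gauge s (U i)" for i
      proof (cases "U i = {}")
        case False
        let ?d = "diameter (U i)"
        have d: "0 \<le> ?d" "?d \<le> 1/2" using U(2,3)[of i] by (auto intro: diameter_ge_0)
        have "?d powr \<alpha> \<le> (if s = 0 then 1 else ?d powr s)"
        proof (cases "?d = 0")
          case False
          then have "?d powr \<alpha> \<le> ?d powr s" using d sa by (intro powr_mono') auto
          then show ?thesis using False d by (auto split: if_splits)
        qed simp
        then have le: "ennreal (C * ?d powr \<alpha>) \<le> ennreal C * hausdorff_gauge s (U i)"
          using False C unfolding hausdorff_gauge_def
          by (auto simp: ennreal_mult[symmetric] ennreal_1[symmetric] intro!: ennreal_leI simp del: ennreal_1)
        have "emeasure \<mu> (B i) \<le> ennreal (C * ?d powr \<alpha>)"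
          unfolding B_def using False emeasure_cball_le[OF sets ball, where d = ?d] s(1) sa d by simp
        then show ?thesis using le by (rule order_trans)
      qed (simp add: B_def)
      have "emeasure \<mu> A \<le> emeasure \<mu> (\<Union>i. B i)"
        using U(1) UB B_sets by (intro emeasure_mono) blast+
      also have "\<dots> \<le> (\<Sum>i. emeasure \<mu> (B i))"
        using B_sets by (intro emeasure_subadditive_countably) auto
      also have "\<dots> \<le> (\<Sum>i. ennreal C * hausdorff_gauge s (U i))"
        using B_le by (intro suminf_le) auto
      also have "\<dots> = ennreal C * (\<Sum>i. hausdorff_gauge s (U i))" by simp
      also have "\<dots> \<le> ennreal C * ennreal (e / C)"
        using U(4) by (intro mult_left_mono) auto
      also have "\<dots> = ennreal e" using C e by (simp add: ennreal_mult[symmetric])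
      finally show "emeasure \<mu> A \<le> 0 + ennreal e" by simp
    qed
    then show False using pos by simp
  qed
qed

section \<open>The support carries the measure\<close>

lemma closed_measure_support: "closed (measure_support \<mu>)"
proof -
  have "- measure_support \<mu> = \<Union>{U. open U \<and> emeasure \<mu> U = 0}"
    by (auto simp: measure_support_def)
  then have "open (- measure_support \<mu>)" by (simp only:) (auto intro!: open_Union)
  then show ?thesis by (simp add: closed_def)
qed

text \<open>
  The complement of the support is a union of open null sets.  Their lifts are open in \<open>\<real>\<^sup>d\<close>, which
  is second countable, so countably many of them suffice; pushing these forward gives a countable
  union of null sets on the torus.
\<close>

lemma emeasure_Compl_measure_support:
  fixes \<mu> :: "'n::finite torus measure"
  assumes sets: "sets \<mu> = sets borel"
  shows "emeasure \<mu> (- measure_support \<mu>) = 0"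
proof -
  let ?F = "(\<lambda>U. to_torus -` U) ` {U :: 'n torus set. open U \<and> emeasure \<mu> U = 0}"
  have "\<And>S. S \<in> ?F \<Longrightarrow> open S" by (auto simp: open_torus_iff)
  then obtain F' where F': "F' \<subseteq> ?F" "countable F'" "\<Union>F' = \<Union>?F" by (rule Lindelof) blast
  have surj: "surj (to_torus :: real ^ 'n \<Rightarrow> 'n torus)"
    unfolding surj_def by (intro allI) (use to_torus_surj in \<open>blast dest: sym\<close>)
  have vim: "to_torus ` (to_torus -` U) = U" for U :: "'n torus set"
    using surj by (rule surj_image_vimage_eq)
  have "- measure_support \<mu> = \<Union>{U. open U \<and> emeasure \<mu> U = 0}"
    by (auto simp: measure_support_def)
  also have "\<dots> = to_torus ` \<Union>?F"
    by (simp only: image_Union image_image vim image_ident)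
  also have "\<dots> = (\<Union>S\<in>F'. to_torus ` S)" by (simp only: F'(3)[symmetric] image_Union)
  finally have eq: "- measure_support \<mu> = (\<Union>S\<in>F'. to_torus ` S)" .
  have "to_torus ` S \<in> null_sets \<mu>" if "S \<in> F'" for S
  proof -
    have "S \<in> ?F" using F'(1) that by (rule subsetD)
    then obtain U where S: "S = to_torus -` U" and U: "U \<in> {U. open U \<and> emeasure \<mu> U = 0}"
      by (rule imageE)
    have "to_torus ` S = U" unfolding S by (rule vim)
    then show ?thesis using U by (simp add: null_sets_def sets)
  qed
  then have "(\<Union>S\<in>F'. to_torus ` S) \<in> null_sets \<mu>" using F'(2) by (intro null_sets_UN') auto
  then show ?thesis unfolding eq by (rule null_setsD1)
qed

theorem theorem1p1:
  fixes \<mu> :: "'n::finite torus measure"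
  assumes "CARD('n) \<ge> 2"
    and "prob_space \<mu>" and "sets \<mu> = sets borel"
    and "trace_inequality \<mu>"
  shows "upper_regular (real CARD('n) - 2) \<mu>
    \<and> hausdorff_dim (measure_support \<mu>) \<ge> ennreal (real CARD('n) - 2)"
proof
  interpret prob_space \<mu> by fact
  show reg: "upper_regular (real CARD('n) - 2) \<mu>"
    using assms(2-4) by (rule upper_regular_of_trace_inequality)
  have "measure_support \<mu> \<in> sets \<mu>" using closed_measure_support[of \<mu>] by (simp add: assms(3))
  moreover have "space \<mu> = UNIV" using sets_eq_imp_space_eq[OF assms(3)] by simp
  ultimately have "emeasure \<mu> (measure_support \<mu>) = 1"
    using emeasure_Compl_measure_support[OF assms(3)] prob_compl[of "measure_support \<mu>"]
    by (simp add: emeasure_eq_measure Compl_eq_Diff_UNIV)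
  then show "hausdorff_dim (measure_support \<mu>) \<ge> ennreal (real CARD('n) - 2)"
    by (intro hausdorff_dim_ge_of_upper_regular[OF assms(3) reg]) simp
qed

end
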